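(* Assume that $\phi$ is Lipschitz continuous on $\mathbf{R}^m$ with constant $L_\phi>0$, that $\|F'(x)-F'(y)\|\le L_F\|x-y\|$ for all $x,y\in\mathbf{R}^n$ with $L_\phi L_F>0$, and that $g$ is strongly convex with a parameter $\tau_g\ge L_\phi L_F$. Let $\{x^k\}_{k\ge0}$ be generated by Algorithm 2 (described in the context). Then, for every $k\ge1$, $$f(x^k)-f(x^* )\le\frac{4L_\phi L_F\|x^0-x^*\|^2}{k(k+1)},$$ where $x^*$ is a stationary point of the problem $\min_{x\in\Omega}f(x)$.
   Context: All norms are Euclidean (operator norm for matrices). $\Omega\subset\mathbf{R}^n$ is nonempty, closed and convex; $g:\mathbf{R}^n\to\mathbf{R}$; $F:\mathbf{R}^n\to\mathbf{R}^m$ is continuously differentiable with Jacobian $F'(x)\in\mathbf{R}^{m\times n}$; $\phi:\mathbf{R}^m\to\mathbf{R}$ is (proper, lower semicontinuous and) convex; $f(x):=g(x)+\phi(F(x))$. The function $g$ is strongly convex with parameter $\tau>0$ if $g-\frac\tau2\|\cdot\|^2$ is convex. A point $x^*\in\Omega$ is stationary if $0\in\partial g(x^* )+F'(x^* )^T\partial\phi(F(x^* ))+N_\Omega(x^* )$, where $\partial$ is the convex subdifferential and $N_\Omega(x^* )=\{w:w^T(y-x^* )\le0\ \forall y\in\Omega\}$. For $x\in\Omega$, $\rho>0$, $\tilde V_\rho(x)$ is the unique minimizer over $y\in\Omega$ of $g(y)+\phi(F(x)+F'(x)(y-x))+\frac\rho2\|y-x\|^2$, and (in this setting) $\tilde G_\rho(x):=\rho(\tilde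 V_\rho(x)-x)$. Algorithm 2. Choose $x^0\in\Omega$, put $\hat L:=L_\phi L_F$ and $\varphi_0(z):=\frac12\|z-x^0\|^2$. For $k=0,1,\dots$: (1) $v^k:=\arg\min\{\varphi_k(z):z\in\Omega\}$; (2) $y^k:=\frac{k}{k+2}x^k+\frac{2}{k+2}v^k$; (3) $x^{k+1}:=\tilde V_{\hat L}(y^k)$; (4) $\varphi_{k+1}(x):=\varphi_k(x)+\frac{k+1}{4\hat L}\left[f(x^{k+1})+\frac1{\hat L}\|\tilde G_{\hat L}(y^k)\|^2-2\,\tilde G_{\hat L}(y^k)^T(x-y^k)\right]$. *)

theory Defs
  imports "HOL-Analysis.Analysis"
begin

definition strongly_convex :: "real \<Rightarrow> ('a::real_inner \<Rightarrow> real) \<Rightarrow> bool" where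
  "strongly_convex \<tau> g \<longleftrightarrow> \<tau> > 0 \<and> convex_on UNIV (\<lambda>x. g x - \<tau> / 2 * (norm x)\<^sup>2)"

definition subdifferential :: "('a::real_inner \<Rightarrow> real) \<Rightarrow> 'a \<Rightarrow> 'a set" where
  "subdifferential h x = {s. \<forall>y. h y \<ge> h x + s \<bullet> (y - x)}"

definition normal_cone :: "'a::real_inner set \<Rightarrow> 'a \<Rightarrow> 'a set" where
  "normal_cone \<Omega> x = {w. \<forall>y\<in>\<Omega>. w \<bullet> (y - x) \<le> 0}"

definition is_jacobian :: "(real^'n \<Rightarrow> real^'m) \<Rightarrow> (real^'n \<Rightarrow> real^'n^'m) \<Rightarrow> bool" where
  "is_jacobian F F' \<longleftrightarrow> (\<forall>x. (F has_derivative (\<lambda>h. F' x *v h)) (at x))"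

definition stationary ::
  "(real^'n) set \<Rightarrow> (real^'n \<Rightarrow> real) \<Rightarrow> (real^'n \<Rightarrow> real^'m) \<Rightarrow> (real^'n \<Rightarrow> real^'n^'m)
    \<Rightarrow> (real^'m \<Rightarrow> real) \<Rightarrow> real^'n \<Rightarrow> bool" where
  "stationary \<Omega> g F F' \<phi> x \<longleftrightarrow> x \<in> \<Omega> \<and>
     0 \<in> {a + transpose (F' x) *v b + w | a b w.
            a \<in> subdifferential g x \<and> b \<in> subdifferential \<phi> (F x) \<and> w \<in> normal_cone \<Omega> x}"

definition objective ::
  "(real^'n \<Rightarrow> real) \<Rightarrow> (real^'n \<Rightarrow> real^'m) \<Rightarrow> (real^'m \<Rightarrow> real) \<Rightarrow> real^'n \<Rightarrow> real" where
  "objective g F \<phi> x = g x + \<phi> (F x)"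

(* arg_min_on is a choice operator; under the standing assumptions (g strongly convex, \<phi> convex,
   \<Omega> nonempty, closed and convex, \<rho> > 0) the minimizer exists and is unique. *)
definition Vtilde ::
  "(real^'n) set \<Rightarrow> (real^'n \<Rightarrow> real) \<Rightarrow> (real^'n \<Rightarrow> real^'m) \<Rightarrow> (real^'n \<Rightarrow> real^'n^'m)
    \<Rightarrow> (real^'m \<Rightarrow> real) \<Rightarrow> real \<Rightarrow> real^'n \<Rightarrow> real^'n" where
  "Vtilde \<Omega> g F F' \<phi> \<rho> x =
     arg_min_on (\<lambda>y. g y + \<phi> (F x + F' x *v (y - x)) + \<rho> / 2 * (norm (y - x))\<^sup>2) \<Omega>"

(* Sign convention: this is the negative of the usual gradient mapping. *)
definition Gtilde ::
  "(real^'n) set \<Rightarrow> (real^'n \<Rightarrow> real) \<Rightarrow> (real^'n \<Rightarrow> real^'m) \<Rightarrow> (real^'n \<Rightarrow> real^'n^'m)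
    \<Rightarrow> (real^'m \<Rightarrow> real) \<Rightarrow> real \<Rightarrow> real^'n \<Rightarrow> real^'n" where
  "Gtilde \<Omega> g F F' \<phi> \<rho> x = \<rho> *\<^sub>R (Vtilde \<Omega> g F F' \<phi> \<rho> x - x)"

(* The estimate functions varphi_k of the algorithm are called \<psi> k here, to keep them apart from
   the outer function \<phi>. *)
definition generated_by_algorithm2 ::
  "(real^'n) set \<Rightarrow> (real^'n \<Rightarrow> real) \<Rightarrow> (real^'n \<Rightarrow> real^'m) \<Rightarrow> (real^'n \<Rightarrow> real^'n^'m)
    \<Rightarrow> (real^'m \<Rightarrow> real) \<Rightarrow> real \<Rightarrow> (nat \<Rightarrow> real^'n) \<Rightarrow> (nat \<Rightarrow> real^'n) \<Rightarrow> (nat \<Rightarrow> real^'n)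
    \<Rightarrow> (nat \<Rightarrow> real^'n \<Rightarrow> real) \<Rightarrow> bool" where
  "generated_by_algorithm2 \<Omega> g F F' \<phi> L x y v \<psi> \<longleftrightarrow>
     x 0 \<in> \<Omega> \<and>
     \<psi> 0 = (\<lambda>z. 1 / 2 * (norm (z - x 0))\<^sup>2) \<and>
     (\<forall>k. v k = arg_min_on (\<psi> k) \<Omega> \<and>
          y k = (real k / (real k + 2)) *\<^sub>R x k + (2 / (real k + 2)) *\<^sub>R v k \<and>
          x (Suc k) = Vtilde \<Omega> g F F' \<phi> L (y k) \<and>
          \<psi> (Suc k) = (\<lambda>z. \<psi> k z + (real k + 1) / (4 * L) *
            (objective g F \<phi> (x (Suc k))
             + 1 / L * (norm (Gtilde \<Omega> g F F' \<phi> L (y k)))\<^sup>2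
             - 2 * (Gtilde \<Omega> g F F' \<phi> L (y k) \<bullet> (z - y k)))))"

end

theory Submission
  imports Defs
begin

text \<open>
  Let \<open>L = L\<^sub>\<phi> * L\<^sub>F\<close>. Linearising \<open>F\<close> at \<open>y\<close> changes the objective \<open>f\<close> at \<open>z\<close> by at most
  \<open>L / 2 * (norm (z - y))\<^sup>2\<close>. The regularised model at \<open>y\<close> is strongly convex with parameter
  \<open>\<tau>\<^sub>g + L \<ge> 2 * L\<close>, and this is exactly enough to absorb both errors: with \<open>p\<close> its minimiser and
  \<open>G = L * (p - y)\<close>, every \<open>z \<in> \<Omega>\<close> satisfies
  \<open>f z \<ge> f p + (norm G)\<^sup>2 / L - 2 * (G \<bullet> (z - y))\<close>, as if \<open>f\<close> were convex. Nesterov's estimate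
  sequence argument then applies: with \<open>A\<^sub>k = k * (k + 1) / (8 * L)\<close> one has
  \<open>A\<^sub>k * f (x k) \<le> min \<psi>\<^sub>k\<close> over \<open>\<Omega>\<close> and \<open>\<psi>\<^sub>k z \<le> (norm (z - x 0))\<^sup>2 / 2 + A\<^sub>k * f z\<close>.
\<close>

section \<open>Strong convexity and quadratic growth at minimisers\<close>

lemma norm_sq_diff:
  fixes z y :: "'a::real_inner"
  shows "(norm (z - y))\<^sup>2 = (norm z)\<^sup>2 - 2 * (y \<bullet> z) + (norm y)\<^sup>2"
  by (simp add: power2_norm_eq_inner inner_diff_left inner_diff_right inner_commute)

lemma convex_on_affine:
  fixes a :: "'a::real_inner"
  shows "convex_on UNIV (\<lambda>z. c + a \<bullet> z)"
proof (rule convex_onI)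
  fix t :: real and u w :: 'a
  show "c + a \<bullet> ((1 - t) *\<^sub>R u + t *\<^sub>R w) \<le> (1 - t) * (c + a \<bullet> u) + t * (c + a \<bullet> w)"
    by (simp add: inner_add_right algebra_simps)
qed simp

lemma strongly_convex_add_convex:
  assumes "strongly_convex \<tau> g" "convex_on UNIV c"
  shows "strongly_convex \<tau> (\<lambda>z. g z + c z)"
  using assms convex_on_add[of UNIV "\<lambda>x. g x - \<tau> / 2 * (norm x)\<^sup>2" c]
  by (simp add: strongly_convex_def algebra_simps)

text \<open>Expanding the square about \<open>p\<close> shows that the difference from the centred
  quadratic is affine, hence convex.\<close>

lemma strongly_convex_half_sq_dist:
  fixes p :: "'a::real_inner"
  assumes "\<rho> > 0"
  shows "strongly_convex \<rho> (\<lambda>z. \<rho> / 2 * (norm (z - p))\<^sup>2)"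
proof -
  have "(\<lambda>z. \<rho> / 2 * (norm (z - p))\<^sup>2 - \<rho> / 2 * (norm z)\<^sup>2)
      = (\<lambda>z. \<rho> / 2 * (norm p)\<^sup>2 + (- \<rho> *\<^sub>R p) \<bullet> z)"
    by (simp add: norm_sq_diff algebra_simps)
  then show ?thesis
    using assms convex_on_affine[of "\<rho> / 2 * (norm p)\<^sup>2" "- \<rho> *\<^sub>R p"]
    by (simp add: strongly_convex_def)
qed

lemma strongly_convex_add:
  assumes "strongly_convex \<sigma> g" "strongly_convex \<tau> h"
  shows "strongly_convex (\<sigma> + \<tau>) (\<lambda>z. g z + h z)"
  using assms convex_on_add[of UNIV "\<lambda>x. g x - \<sigma> / 2 * (norm x)\<^sup>2" "\<lambda>x. h x - \<tau> / 2 * (norm x)\<^sup>2"]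
  by (simp add: strongly_convex_def algebra_simps add_divide_distrib)

lemma strongly_convexD:
  fixes u w :: "'a::real_inner"
  assumes "strongly_convex \<sigma> h" "0 \<le> t" "t \<le> 1"
  shows "h ((1 - t) *\<^sub>R u + t *\<^sub>R w)
    \<le> (1 - t) * h u + t * h w - \<sigma> / 2 * (t * (1 - t)) * (norm (w - u))\<^sup>2"
proof -
  define q where "q = (1 - t) *\<^sub>R u + t *\<^sub>R w"
  define s where "s = \<sigma> / 2"
  have "h q - s * (norm q)\<^sup>2
      \<le> (1 - t) * (h u - s * (norm u)\<^sup>2) + t * (h w - s * (norm w)\<^sup>2)"
    using assms convex_onD[of UNIV "\<lambda>x. h x - \<sigma> / 2 * (norm x)\<^sup>2" t u w]
    by (auto simp: strongly_convex_def q_def s_def)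
  moreover have "(norm q)\<^sup>2
      = (1 - t) * (norm u)\<^sup>2 + t * (norm w)\<^sup>2 - t * (1 - t) * (norm (w - u))\<^sup>2"
    unfolding power2_norm_eq_inner q_def
    by (simp add: inner_add_left inner_add_right inner_diff_left inner_diff_right inner_commute
        algebra_simps power2_eq_square)
  ultimately have "h q \<le> (1 - t) * h u + t * h w - s * (t * (1 - t)) * (norm (w - u))\<^sup>2"
    by (simp add: algebra_simps)
  then show ?thesis
    unfolding q_def s_def .
qed

text \<open>Compare \<open>p\<close> with the point of the segment to \<open>z\<close> that has
  weight \<open>t = 1 - s\<close> on \<open>z\<close>. Minimality of \<open>p\<close> and division
  by \<open>t\<close> leave the bound with factor \<open>s\<close>; then let \<open>s\<close> tend
  to 1.\<close>

lemma strongly_convex_minimizer_growth: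
  fixes p z :: "'a::real_inner"
  assumes sc: "strongly_convex \<sigma> h" and "convex S" "p \<in> S" "z \<in> S"
    and min: "\<And>w. w \<in> S \<Longrightarrow> h p \<le> h w"
  shows "h p + \<sigma> / 2 * (norm (z - p))\<^sup>2 \<le> h z"
proof -
  have "\<sigma> / 2 * (norm (z - p))\<^sup>2 \<le> h z - h p"
  proof (rule field_le_mult_one_interval)
    fix s :: real
    assume s: "0 < s" "s < 1"
    define t where "t = 1 - s"
    have "(1 - t) *\<^sub>R p + t *\<^sub>R z \<in> S"
      using assms s by (intro convexD) (auto simp: t_def)
    then have "h p \<le> (1 - t) * h p + t * h z - \<sigma> / 2 * (t * (1 - t)) * (norm (z - p))\<^sup>2"
      using min strongly_convexD[OF sc, of t p z] s by (fastforce simp: t_def)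
    then have "t * (s * (\<sigma> / 2 * (norm (z - p))\<^sup>2)) \<le> t * (h z - h p)"
      by (simp add: t_def algebra_simps)
    then show "s * (\<sigma> / 2 * (norm (z - p))\<^sup>2) \<le> h z - h p"
      using s by (simp add: t_def)
  qed
  then show ?thesis by simp
qed

section \<open>Existence of constrained minimisers\<close>

text \<open>Compactness bounds \<open>c\<close> on the unit ball. Beyond it,
  \<open>z / norm z\<close> lies between 0 and \<open>z\<close>, so a steep descent towards
  \<open>z\<close> would by convexity violate the bound already on the unit sphere.\<close>

lemma convex_lower_bound_linear:
  fixes c :: "'a::euclidean_space \<Rightarrow> real"
  assumes "convex_on UNIV c"
  obtains M where "M \<ge> 0" "\<And>z. c z \<ge> - M * (1 + norm z)"
proof -
  have cont: "continuous_on UNIV c"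
    using assms by (intro convex_on_continuous) auto
  have "bounded (c ` cball 0 1)"
    by (intro compact_imp_bounded compact_continuous_image continuous_on_subset[OF cont]) auto
  then obtain B where "\<forall>q\<in>cball 0 1. \<bar>c q\<bar> \<le> B"
    by (auto simp: bounded_iff)
  then have B: "\<And>q. norm q \<le> 1 \<Longrightarrow> \<bar>c q\<bar> \<le> B"
    by simp
  have B0: "B \<ge> 0"
    using B[of 0] by auto
  have "c z \<ge> - (2 * B) * (1 + norm z)" for z
  proof (cases "norm z \<le> 1")
    case True
    then have "- B \<le> c z" using B[of z] by auto
    moreover have "0 \<le> B * norm z" using B0 by simp
    moreover have "- (2 * B) * (1 + norm z) = - (2 * B) - 2 * (B * norm z)"
      by (simp add: algebra_simps)
    ultimately show ?thesis using B0 by linarith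
  next
    case False
    define t where "t = norm z"
    have t: "t > 1" using False by (simp add: t_def)
    have "c ((1 - 1 / t) *\<^sub>R 0 + (1 / t) *\<^sub>R z) \<le> (1 - 1 / t) * c 0 + (1 / t) * c z"
      using assms t by (intro convex_onD) auto
    then have "t * c ((1 / t) *\<^sub>R z) \<le> t * ((1 - 1 / t) * c 0 + (1 / t) * c z)"
      using t by (intro mult_left_mono) auto
    also have "\<dots> = (t - 1) * c 0 + c z"
      using t by (simp add: field_simps)
    finally have 1: "t * c ((1 / t) *\<^sub>R z) \<le> (t - 1) * c 0 + c z" .
    have "norm ((1 / t) *\<^sub>R z) \<le> 1"
      by (simp add: t_def)
    then have "- B \<le> c ((1 / t) *\<^sub>R z)"
      using B by fastforce
    then have 2: "t * (- B) \<le> t * c ((1 / t) *\<^sub>R z)"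
      using t by (intro mult_left_mono) auto
    have "(t - 1) * c 0 \<le> (t - 1) * B"
      using B[of 0] t by (intro mult_left_mono) auto
    with 1 2 B0 show ?thesis unfolding t_def[symmetric] by (simp add: algebra_simps)
  qed
  with B0 show ?thesis by (intro that[of "2 * B"]) auto
qed

text \<open>The quadratic part outgrows the at most linear decrease of the convex part, so the
  search can be confined to a compact piece of \<open>S\<close>.\<close>

lemma strongly_convex_attains_min:
  fixes h :: "'a::euclidean_space \<Rightarrow> real"
  assumes sc: "strongly_convex \<sigma> h" and S: "closed S" "S \<noteq> {}"
  obtains p where "p \<in> S" "\<And>z. z \<in> S \<Longrightarrow> h p \<le> h z"
proof -
  define c where "c = (\<lambda>x. h x - \<sigma> / 2 * (norm x)\<^sup>2)"
  have \<sigma>: "\<sigma> > 0" and cc: "convex_on UNIV c"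
    using sc by (auto simp: strongly_convex_def c_def)
  have heq: "h = (\<lambda>x. c x + \<sigma> / 2 * (norm x)\<^sup>2)"
    by (auto simp: c_def)
  have "continuous_on UNIV c"
    using cc by (intro convex_on_continuous) auto
  then have cont: "continuous_on UNIV h"
    unfolding heq by (intro continuous_intros)
  obtain M where M: "M \<ge> 0" "\<And>z. c z \<ge> - M * (1 + norm z)"
    using convex_lower_bound_linear[OF cc] by blast
  obtain s where s: "s \<in> S" using S by auto
  \<comment> \<open>The three entries put \<open>s\<close> inside the ball, give
    \<open>M \<le> norm z * M\<close> outside it, and make \<open>\<sigma> / 2 * norm z\<close>
    exceed \<open>2 * M + \<bar>h s\<bar>\<close> there.\<close>
  define R where "R = max (norm s) (max 1 (2 * (2 * M + \<bar>h s\<bar>) / \<sigma>))"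
  have far: "h s < h z" if "norm z > R" for z
  proof -
    have r: "norm z > 1" "2 * (2 * M + \<bar>h s\<bar>) / \<sigma> < norm z"
      using that by (auto simp: R_def)
    then have "2 * M + \<bar>h s\<bar> < \<sigma> / 2 * norm z"
      using \<sigma> by (simp add: field_simps)
    then have "norm z * (2 * M + \<bar>h s\<bar>) < norm z * (\<sigma> / 2 * norm z)"
      using r by (intro mult_strict_left_mono) auto
    moreover have "1 * \<bar>h s\<bar> \<le> norm z * \<bar>h s\<bar>"
      using r by (intro mult_right_mono) auto
    moreover have "1 * M \<le> norm z * M"
      using r M(1) by (intro mult_right_mono) auto
    ultimately show ?thesis
      using M(2)[of z] unfolding heq[THEN fun_cong, of z]
      by (simp add: algebra_simps power2_eq_square)
  qed
  have "compact (S \<inter> cball 0 R)" "S \<inter> cball 0 R \<noteq> {}"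
    using S s by (auto simp: closed_Int_compact R_def)
  then obtain p where p: "p \<in> S \<inter> cball 0 R" "\<And>z. z \<in> S \<inter> cball 0 R \<Longrightarrow> h p \<le> h z"
    using continuous_attains_inf[of "S \<inter> cball 0 R" h] continuous_on_subset[OF cont] by blast
  have "h p \<le> h z" if "z \<in> S" for z
  proof (cases "norm z \<le> R")
    case True
    with that p show ?thesis by auto
  next
    case False
    then have "h s < h z" using far by auto
    moreover have "h p \<le> h s" using p s by (auto simp: R_def)
    ultimately show ?thesis by simp
  qed
  with p that show ?thesis by auto
qed

text \<open>\<open>arg_min_on\<close> is a choice operator; existence of a minimiser is what makes
  its value one. The growth term also forces uniqueness.\<close>

lemma arg_min_on_strongly_convex:
  fixes h :: "'a::euclidean_space \<Rightarrow> real"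
  assumes sc: "strongly_convex \<sigma> h" and S: "closed S" "S \<noteq> {}" "convex S"
  shows "arg_min_on h S \<in> S"
    and "z \<in> S \<Longrightarrow> h (arg_min_on h S) + \<sigma> / 2 * (norm (z - arg_min_on h S))\<^sup>2 \<le> h z"
proof -
  obtain p where "p \<in> S" "\<And>w. w \<in> S \<Longrightarrow> h p \<le> h w"
    using strongly_convex_attains_min[OF sc S(1,2)] by blast
  then have "is_arg_min h (\<lambda>x. x \<in> S) p"
    by (auto simp: is_arg_min_linorder)
  then have *: "is_arg_min h (\<lambda>x. x \<in> S) (arg_min_on h S)"
    unfolding arg_min_on_def arg_min_def by (rule someI)
  then show "arg_min_on h S \<in> S"
    by (simp add: is_arg_min_linorder)
  with * show "z \<in> S \<Longrightarrow> h (arg_min_on h S) + \<sigma> / 2 * (norm (z - arg_min_on h S))\<^sup>2 \<le> h z"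
    by (intro strongly_convex_minimizer_growth[OF sc S(3)]) (auto simp: is_arg_min_linorder)
qed

section \<open>Error of linearising the inner map\<close>

text \<open>Along the segment from \<open>y\<close> to \<open>z\<close> the error has speed at most
  \<open>M * t * (norm d)\<^sup>2\<close>; integrating over \<open>[0, 1]\<close> produces the
  factor 1/2.\<close>

lemma jacobian_linearization_error:
  fixes F :: "real^'n \<Rightarrow> real^'m"
  assumes jac: "is_jacobian F F'"
    and lip: "\<And>p q. onorm (\<lambda>h. (F' p - F' q) *v h) \<le> M * norm (p - q)"
  shows "norm (F z - (F y + F' y *v (z - y))) \<le> M / 2 * (norm (z - y))\<^sup>2"
proof -
  define d where "d = z - y"
  \<comment> \<open>Subtracting the linear term makes \<open>e 1 - e 0\<close> exactly the
    linearisation error.\<close>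
  define e where "e = (\<lambda>t. F (y + t *\<^sub>R d) - t *\<^sub>R (F' y *v d))"
  define e' where "e' = (\<lambda>t. (F' (y + t *\<^sub>R d) - F' y) *v d)"
  have F: "(F has_derivative (\<lambda>h. F' x *v h)) (at x within X)" for x X
    using jac by (auto simp: is_jacobian_def intro: has_derivative_at_withinI)
  have ed: "(e has_vector_derivative e' t) (at t)" for t
  proof -
    have "((\<lambda>t. y + t *\<^sub>R d) has_derivative (\<lambda>s. s *\<^sub>R d)) (at t)"
      by (auto intro!: derivative_eq_intros)
    from has_derivative_compose[OF this F]
    have "((\<lambda>t. F (y + t *\<^sub>R d)) has_derivative (\<lambda>s. F' (y + t *\<^sub>R d) *v (s *\<^sub>R d))) (at t)" .
    then have "((\<lambda>t. F (y + t *\<^sub>R d)) has_vector_derivative F' (y + t *\<^sub>R d) *v d) (at t)"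
      by (simp add: has_vector_derivative_def matrix_vector_mult_scaleR)
    then show ?thesis
      unfolding e_def e'_def
      by (auto intro!: derivative_eq_intros simp: matrix_vector_mult_diff_rdistrib)
  qed
  have qd: "((\<lambda>t. M / 2 * t\<^sup>2 * (norm d)\<^sup>2) has_vector_derivative M * t * (norm d)\<^sup>2) (at t)" for t
    unfolding has_real_derivative_iff_has_vector_derivative[symmetric]
    by (auto intro!: derivative_eq_intros)
  have "norm (e 1 - e 0) \<le> M / 2 * 1\<^sup>2 * (norm d)\<^sup>2 - M / 2 * 0\<^sup>2 * (norm d)\<^sup>2"
  proof (rule differentiable_bound_general)
    show "continuous_on {0..1} e"
      using ed by (meson continuous_on_vector_derivative has_vector_derivative_at_within)
    show "norm (e' t) \<le> M * t * (norm d)\<^sup>2" if "0 < t" "t < 1" for t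
    proof -
      have "norm (e' t) \<le> onorm (\<lambda>h. (F' (y + t *\<^sub>R d) - F' y) *v h) * norm d"
        unfolding e'_def by (intro onorm matrix_vector_mul_bounded_linear)
      also have "\<dots> \<le> (M * norm (y + t *\<^sub>R d - y)) * norm d"
        by (intro mult_right_mono lip) auto
      finally show ?thesis
        using that by (simp add: power2_eq_square)
    qed
  qed (use ed qd in \<open>auto intro!: continuous_intros\<close>)
  then show ?thesis
    by (simp add: e_def d_def algebra_simps)
qed

text \<open>The bound is two-sided because the model must dominate \<open>f\<close> at its minimiser
  and be dominated at the comparison point, each up to a quadratic.\<close>

lemma composite_linearization_error:
  fixes F :: "real^'n \<Rightarrow> real^'m"
  assumes "is_jacobian F F'"
    and "\<And>p q. onorm (\<lambda>h. (F' p - F' q) *v h) \<le> M * norm (p - q)"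
    and "K-lipschitz_on UNIV \<phi>"
  shows "\<bar>\<phi> (F z) - \<phi> (F y + F' y *v (z - y))\<bar> \<le> K * M / 2 * (norm (z - y))\<^sup>2"
proof -
  have "\<bar>\<phi> (F z) - \<phi> (F y + F' y *v (z - y))\<bar> \<le> K * norm (F z - (F y + F' y *v (z - y)))"
    using lipschitz_onD[OF assms(3)] by (simp add: dist_norm)
  also have "\<dots> \<le> K * (M / 2 * (norm (z - y))\<^sup>2)"
    using jacobian_linearization_error[OF assms(1,2)] lipschitz_on_nonneg[OF assms(3)]
    by (intro mult_left_mono)
  finally show ?thesis by simp
qed

lemma convex_on_linearization:
  fixes A :: "real^'n^'m"
  assumes "convex_on UNIV \<phi>"
  shows "convex_on UNIV (\<lambda>z. \<phi> (b + A *v (z - y)))"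
proof (rule convex_onI)
  fix t :: real and u w :: "real^'n"
  assume "0 < t" "t < 1"
  moreover have "b + A *v ((1 - t) *\<^sub>R u + t *\<^sub>R w - y)
      = (1 - t) *\<^sub>R (b + A *v (u - y)) + t *\<^sub>R (b + A *v (w - y))"
    by (simp add: matrix_vector_mult_diff_distrib matrix_vector_right_distrib
        matrix_vector_mult_scaleR algebra_simps)
  ultimately show "\<phi> (b + A *v ((1 - t) *\<^sub>R u + t *\<^sub>R w - y))
      \<le> (1 - t) * \<phi> (b + A *v (u - y)) + t * \<phi> (b + A *v (w - y))"
    using convex_onD[OF assms] by simp
qed simp

section \<open>The regularised step and the estimate-sequence recursion\<close>

text \<open>The estimate-sequence argument uses \<open>g\<close>, \<open>F\<close> and
  \<open>\<phi>\<close> only through these two facts.\<close>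

lemma Vtilde_lower_bound:
  fixes F :: "real^'n \<Rightarrow> real^'m" and K M :: real
  defines "L \<equiv> K * M"
  assumes \<Omega>: "\<Omega> \<noteq> {}" "closed \<Omega>" "convex \<Omega>"
    and err: "is_jacobian F F'"
      "\<And>p q. onorm (\<lambda>h. (F' p - F' q) *v h) \<le> M * norm (p - q)"
      "K-lipschitz_on UNIV \<phi>"
    and \<phi>: "convex_on UNIV \<phi>"
    and L: "L > 0"
    and g: "strongly_convex \<tau> g" "\<tau> \<ge> L"
  shows "Vtilde \<Omega> g F F' \<phi> L y \<in> \<Omega>"
    and "z \<in> \<Omega> \<Longrightarrow> objective g F \<phi> (Vtilde \<Omega> g F F' \<phi> L y)
      + 1 / L * (norm (Gtilde \<Omega> g F F' \<phi> L y))\<^sup>2 - 2 * (Gtilde \<Omega> g F F' \<phi> L y \<bullet> (z - y))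
      \<le> objective g F \<phi> z"
proof -
  define m where "m = (\<lambda>z. g z + \<phi> (F y + F' y *v (z - y)) + L / 2 * (norm (z - y))\<^sup>2)"
  define p where "p = Vtilde \<Omega> g F F' \<phi> L y"
  have p: "p = arg_min_on m \<Omega>"
    by (simp add: p_def m_def Vtilde_def)
  have m: "strongly_convex (\<tau> + L) m"
    unfolding m_def
    by (intro strongly_convex_add strongly_convex_add_convex strongly_convex_half_sq_dist
        convex_on_linearization g \<phi> L)
  show "Vtilde \<Omega> g F F' \<phi> L y \<in> \<Omega>"
    unfolding p_def[symmetric] p by (intro arg_min_on_strongly_convex[OF m] \<Omega>)
  assume "z \<in> \<Omega>"
  then have "m p + (\<tau> + L) / 2 * (norm (z - p))\<^sup>2 \<le> m z"
    unfolding p by (intro arg_min_on_strongly_convex[OF m] \<Omega>)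
  moreover have "L * (norm (z - p))\<^sup>2 \<le> (\<tau> + L) / 2 * (norm (z - p))\<^sup>2"
    using g by (intro mult_right_mono) auto
  \<comment> \<open>At \<open>p\<close> the regulariser in \<open>m p\<close> covers the
    linearisation error; at \<open>z\<close> error and regulariser, each with coefficient
    \<open>L / 2\<close>, add up to \<open>L\<close>.\<close>
  moreover have "g p + \<phi> (F p) \<le> m p" and "m z \<le> g z + \<phi> (F z) + L * (norm (z - y))\<^sup>2"
    using composite_linearization_error[OF err, where y = y, of p]
      composite_linearization_error[OF err, where y = y, of z]
    unfolding m_def L_def by argo+
  ultimately have "objective g F \<phi> p + L * ((norm (z - p))\<^sup>2 - (norm (z - y))\<^sup>2) \<le> objective g F \<phi> z"
    unfolding objective_def right_diff_distrib by linarith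
  \<comment> \<open>Write \<open>z - p = (z - y) - (p - y)\<close>; the squares of
    \<open>z - y\<close> cancel.\<close>
  moreover have "L * ((norm (z - p))\<^sup>2 - (norm (z - y))\<^sup>2)
      = 1 / L * (norm (L *\<^sub>R (p - y)))\<^sup>2 - 2 * (L *\<^sub>R (p - y) \<bullet> (z - y))"
  proof -
    have "(norm (z - p))\<^sup>2 - (norm (z - y))\<^sup>2 = (norm (p - y))\<^sup>2 - 2 * ((p - y) \<bullet> (z - y))"
      by (simp add: power2_norm_eq_inner inner_diff_left inner_diff_right inner_commute)
    moreover have "1 / L * (norm (L *\<^sub>R (p - y)))\<^sup>2 = L * (norm (p - y))\<^sup>2"
      using L by (simp only: norm_scaleR power_mult_distrib) (simp add: power2_eq_square)
    ultimately show ?thesis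
      by (simp only: inner_scaleR_left) (simp only: right_diff_distrib mult.left_commute)
  qed
  ultimately show "objective g F \<phi> (Vtilde \<Omega> g F F' \<phi> L y)
      + 1 / L * (norm (Gtilde \<Omega> g F F' \<phi> L y))\<^sup>2 - 2 * (Gtilde \<Omega> g F F' \<phi> L y \<bullet> (z - y))
      \<le> objective g F \<phi> z"
    by (simp add: Gtilde_def p_def)
qed

text \<open>With \<open>A\<^sub>k\<close> as above and \<open>a\<^sub>k = A\<^sub>k\<^sub>+\<^sub>1 - A\<^sub>k = (k + 1) / (4 * L)\<close>, the choice of
  \<open>y\<close> makes \<open>A\<^sub>k * (x\<^sub>k - y) + a\<^sub>k * (v - y)\<close> vanish, and \<open>2 * a\<^sub>k\<^sup>2 \<le> (A\<^sub>k + a\<^sub>k) / L\<close> lets the term in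
  \<open>(norm G)\<^sup>2\<close> complete the square.\<close>

lemma estimate_sequence_step:
  fixes xk v y G z :: "'a::real_inner" and L fk f' :: real
  assumes L: "L > 0"
    and y: "y = (real k / (real k + 2)) *\<^sub>R xk + (2 / (real k + 2)) *\<^sub>R v"
    and lower: "f' + 1 / L * (norm G)\<^sup>2 - 2 * (G \<bullet> (xk - y)) \<le> fk"
    and \<psi>: "real k * (real k + 1) / (8 * L) * fk + 1 / 2 * (norm (z - v))\<^sup>2 \<le> \<psi>"
  shows "(real k + 1) * (real k + 2) / (8 * L) * f'
    \<le> \<psi> + (real k + 1) / (4 * L) * (f' + 1 / L * (norm G)\<^sup>2 - 2 * (G \<bullet> (z - y)))"
proof -
  define a where "a = (real k + 1) / (4 * L)"
  define A where "A = real k * (real k + 1) / (8 * L)"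
  have A0: "A \<ge> 0" using L by (simp add: A_def)
  have Aa: "(real k + 1) * (real k + 2) / (8 * L) = A + a"
    using L by (simp add: A_def a_def field_simps)
  have A_eq: "A = a * (real k / 2)" using L by (simp add: A_def a_def field_simps)
  \<comment> \<open>Clearing denominators gives \<open>k * (xk - y) + 2 * (v - y) = 0\<close>;
    scaled by \<open>a / 2\<close>, this carries the weights \<open>A\<close> and
    \<open>a\<close>.\<close>
  have "(real k + 2) * (real k / (real k + 2)) = real k" "(real k + 2) * (2 / (real k + 2)) = 2"
    by (simp_all add: field_simps)
  then have "(real k + 2) *\<^sub>R y = real k *\<^sub>R xk + 2 *\<^sub>R v"
    by (simp only: y scaleR_add_right scaleR_scaleR)
  then have "G \<bullet> ((real k + 2) *\<^sub>R y) = G \<bullet> (real k *\<^sub>R xk + 2 *\<^sub>R v)" by simp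
  then have "real k / 2 * (G \<bullet> (xk - y)) + G \<bullet> (v - y) = 0"
    by (simp add: inner_add_right inner_diff_right algebra_simps)
  then have "a * (real k / 2 * (G \<bullet> (xk - y)) + G \<bullet> (v - y)) = 0" by simp
  then have bary: "A * (G \<bullet> (xk - y)) + a * (G \<bullet> (v - y)) = 0"
    by (simp add: A_eq algebra_simps add_divide_distrib diff_divide_distrib)
  \<comment> \<open>The displacement \<open>2 * a * G\<close> from \<open>v\<close> minimises
    \<open>(norm (z - v))\<^sup>2 / 2 - 2 * a * (G \<bullet> (z - v))\<close>.\<close>
  have "0 \<le> (norm ((z - v) - (2 * a) *\<^sub>R G))\<^sup>2" by simp
  also have "\<dots> = (norm (z - v))\<^sup>2 - 4 * a * (G \<bullet> (z - v)) + 4 * a\<^sup>2 * (norm G)\<^sup>2"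
    by (simp add: norm_sq_diff[of "z - v"] power_mult_distrib)
  finally have square: "2 * a * (G \<bullet> (z - v)) \<le> 1 / 2 * (norm (z - v))\<^sup>2 + 2 * a\<^sup>2 * (norm G)\<^sup>2"
    by simp
  \<comment> \<open>After cancellation this is
    \<open>(k + 1)\<^sup>2 \<le> (k + 1) * (k + 2)\<close>.\<close>
  have "2 * a\<^sup>2 \<le> (real k + 1) * (real k + 2) / (8 * L) * (1 / L)"
    unfolding a_def using L by (simp add: field_simps power2_eq_square)
  then have "2 * a\<^sup>2 \<le> (A + a) * (1 / L)"
    unfolding Aa .
  then have weight: "2 * a\<^sup>2 * (norm G)\<^sup>2 \<le> (A + a) * (1 / L) * (norm G)\<^sup>2"
    by (intro mult_right_mono) auto
  have split: "a * (G \<bullet> (z - y)) = a * (G \<bullet> (z - v)) + a * (G \<bullet> (v - y))"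
    by (simp add: inner_diff_right algebra_simps)
  have "A * (f' + 1 / L * (norm G)\<^sup>2 - 2 * (G \<bullet> (xk - y))) \<le> A * fk"
    using lower A0 by (rule mult_left_mono)
  \<comment> \<open>\<open>square\<close> absorbs the part along \<open>z - v\<close>,
    \<open>bary\<close> cancels the part along \<open>v - y\<close> against the inner product from
    \<open>lower\<close>, and \<open>weight\<close> pays for the square of \<open>G\<close>.\<close>
  then have "(A + a) * f' \<le> \<psi> + a * (f' + 1 / L * (norm G)\<^sup>2 - 2 * (G \<bullet> (z - y)))"
    using \<psi>[folded A_def] bary square weight split by (simp add: algebra_simps add_divide_distrib)
  then show ?thesis
    unfolding Aa a_def .
qed

section \<open>Two-sided bounds on the estimate functions and the rate\<close>

theorem theorem5p1:
  fixes \<Omega> :: "(real^'n) set"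
    and g :: "real^'n \<Rightarrow> real"
    and F :: "real^'n \<Rightarrow> real^'m"
    and F' :: "real^'n \<Rightarrow> real^'n^'m"
    and \<phi> :: "real^'m \<Rightarrow> real"
    and L\<^sub>\<phi> L\<^sub>F \<tau>\<^sub>g :: real
    and x y v :: "nat \<Rightarrow> real^'n"
    and \<psi> :: "nat \<Rightarrow> real^'n \<Rightarrow> real"
    and xstar :: "real^'n"
    and k :: nat
  assumes "\<Omega> \<noteq> {}" "closed \<Omega>" "convex \<Omega>"
    and "is_jacobian F F'" "continuous_on UNIV F'"
    and "convex_on UNIV \<phi>"
    and "L\<^sub>\<phi> > 0" "L\<^sub>\<phi>-lipschitz_on UNIV \<phi>"
    and "\<And>p q. onorm (\<lambda>h. (F' p - F' q) *v h) \<le> L\<^sub>F * norm (p - q)"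
    and "L\<^sub>\<phi> * L\<^sub>F > 0"
    and "strongly_convex \<tau>\<^sub>g g" "\<tau>\<^sub>g \<ge> L\<^sub>\<phi> * L\<^sub>F"
    and "generated_by_algorithm2 \<Omega> g F F' \<phi> (L\<^sub>\<phi> * L\<^sub>F) x y v \<psi>"
    and "stationary \<Omega> g F F' \<phi> xstar"
    and "k \<ge> 1"
  shows "objective g F \<phi> (x k) - objective g F \<phi> xstar
           \<le> 4 * L\<^sub>\<phi> * L\<^sub>F * (norm (x 0 - xstar))\<^sup>2 / (real k * (real k + 1))"
proof -
  define L where "L = L\<^sub>\<phi> * L\<^sub>F"
  define f where "f = objective g F \<phi>"
  define G where "G = (\<lambda>k. Gtilde \<Omega> g F F' \<phi> L (y k))"
  have L: "L > 0" using assms(10) by (simp add: L_def)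
  have x0: "x 0 \<in> \<Omega>" and \<psi>0: "\<psi> 0 = (\<lambda>z. 1 / 2 * (norm (z - x 0))\<^sup>2)"
    and v: "v k = arg_min_on (\<psi> k) \<Omega>"
    and y: "y k = (real k / (real k + 2)) *\<^sub>R x k + (2 / (real k + 2)) *\<^sub>R v k"
    and x_Suc: "x (Suc k) = Vtilde \<Omega> g F F' \<phi> L (y k)"
    and \<psi>_Suc: "\<psi> (Suc k) = (\<lambda>z. \<psi> k z + (real k + 1) / (4 * L) *
      (f (x (Suc k)) + 1 / L * (norm (G k))\<^sup>2 - 2 * (G k \<bullet> (z - y k))))" for k
    using assms(13) unfolding generated_by_algorithm2_def L_def[symmetric] f_def G_def by blast+
  note V = Vtilde_lower_bound[OF assms(1-4,9,8,6,10,11,12), folded L_def, folded f_def]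
  have x_in: "x k \<in> \<Omega>" for k
    by (cases k) (auto simp: x0 x_Suc V(1))
  have lower: "f (x (Suc k)) + 1 / L * (norm (G k))\<^sup>2 - 2 * (G k \<bullet> (z - y k)) \<le> f z"
    if "z \<in> \<Omega>" for z k
    using V(2)[OF that] by (simp add: x_Suc G_def)
  \<comment> \<open>Every update adds an affine function, so the modulus 1 of
    \<open>\<psi> 0\<close> persists.\<close>
  have \<psi>_sc: "strongly_convex 1 (\<psi> k)" for k
  proof (induction k)
    case 0
    then show ?case
      using strongly_convex_half_sq_dist[of 1 "x 0"] by (simp add: \<psi>0)
  next
    case (Suc k)
    define a where "a = (real k + 1) / (4 * L)"
    have "\<psi> (Suc k) = (\<lambda>z. \<psi> k z + (a * (f (x (Suc k)) + 1 / L * (norm (G k))\<^sup>2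
        + 2 * (G k \<bullet> y k)) + ((- 2 * a) *\<^sub>R G k) \<bullet> z))"
      unfolding \<psi>_Suc a_def[symmetric] by (simp add: inner_diff_right algebra_simps)
    then show ?case
      by (simp only: strongly_convex_add_convex[OF Suc.IH convex_on_affine])
  qed
  have v_in: "v k \<in> \<Omega>"
    and growth: "z \<in> \<Omega> \<Longrightarrow> \<psi> k (v k) + 1 / 2 * (norm (z - v k))\<^sup>2 \<le> \<psi> k z" for k z
    unfolding v using arg_min_on_strongly_convex[OF \<psi>_sc assms(2,1,3)] by auto
  \<comment> \<open>The weight vanishes at \<open>k = 0\<close>, leaving nonnegativity of a square.
    The induction step evaluates the recursion at \<open>v (Suc k)\<close>, the minimiser of the
    next estimate function.\<close>
  have min: "real k * (real k + 1) / (8 * L) * f (x k) \<le> \<psi> k (v k)" for k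
  proof (induction k)
    case 0
    then show ?case by (simp add: \<psi>0)
  next
    case (Suc k)
    have "real k * (real k + 1) / (8 * L) * f (x k) + 1 / 2 * (norm (v (Suc k) - v k))\<^sup>2
        \<le> \<psi> k (v (Suc k))"
      using Suc.IH growth[OF v_in] by (meson add_right_mono order_trans)
    from estimate_sequence_step[OF L y lower[OF x_in] this]
    show ?case by (simp add: \<psi>_Suc add.commute)
  qed
  \<comment> \<open>Each bracket added to \<open>\<psi>\<close> is at most \<open>f z\<close> by
    \<open>lower\<close>, and the weights \<open>(k + 1) / (4 * L)\<close> telescope.\<close>
  have max: "\<psi> k z \<le> 1 / 2 * (norm (z - x 0))\<^sup>2 + real k * (real k + 1) / (8 * L) * f z"
    if "z \<in> \<Omega>" for k z
  proof (induction k)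
    case 0
    then show ?case by (simp add: \<psi>0)
  next
    case (Suc k)
    have "(real k + 1) / (4 * L) * (f (x (Suc k)) + 1 / L * (norm (G k))\<^sup>2 - 2 * (G k \<bullet> (z - y k)))
        \<le> (real k + 1) / (4 * L) * f z"
      using lower[OF that] L by (intro mult_left_mono) auto
    moreover have "real (Suc k) * (real (Suc k) + 1) / (8 * L) * f z
        = real k * (real k + 1) / (8 * L) * f z + (real k + 1) / (4 * L) * f z"
      using L by (simp add: field_simps)
    ultimately show ?case
      using Suc.IH unfolding \<psi>_Suc by linarith
  qed
  have xstar: "xstar \<in> \<Omega>" using assms(14) by (simp add: stationary_def)
  define A where "A = real k * (real k + 1) / (8 * L)"
  have A: "A > 0" using L \<open>k \<ge> 1\<close> by (simp add: A_def)
  \<comment> \<open>Both bounds meet at \<open>xstar\<close>; positivity of \<open>A\<close>, from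
    \<open>k \<ge> 1\<close>, then permits division.\<close>
  have "A * f (x k) \<le> \<psi> k (v k)" using min by (simp add: A_def)
  also have "\<dots> \<le> \<psi> k xstar"
    by (rule order_trans[OF _ growth[OF xstar]]) simp
  also have "\<dots> \<le> 1 / 2 * (norm (x 0 - xstar))\<^sup>2 + A * f xstar"
    using max[OF xstar] by (simp add: A_def norm_minus_commute)
  finally have "f (x k) - f xstar \<le> (norm (x 0 - xstar))\<^sup>2 / (2 * A)"
    using A by (simp add: field_simps)
  also have "\<dots> = 4 * L\<^sub>\<phi> * L\<^sub>F * (norm (x 0 - xstar))\<^sup>2 / (real k * (real k + 1))"
  proof -
    have "2 * A = real k * (real k + 1) / (4 * L)" by (simp add: A_def)
    then show ?thesis by (simp add: L_def mult_ac)
  qed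
  finally show ?thesis by (simp add: f_def)
qed

end
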